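(* Let $\mathfrak k$ be a 3-step nilpotent Lie algebra with $\dim\mathcal Z(\mathfrak k)=1$. Then the following assertions are equivalent: (1) The Lie algebra $\mathfrak k$ is of type $(A_+)$. (2) The Lie algebra $\mathfrak k$ is of type $(A)$ and admits a grading of type $(A_+)$.
   Context: $\mathbb K$ is an arbitrary field of characteristic different from $2$; all vector spaces and Lie algebras are finite-dimensional over $\mathbb K$; $\dotplus$ denotes direct sum of vector (sub)spaces. For a Lie algebra $\mathfrak k$: $\mathcal Z(\mathfrak k)$ is the center and $\mathcal C_2\mathfrak k=\{X\in\mathfrak k\mid[\mathfrak k,[\mathfrak k,X]]=0\}$ is the second center. "3-step nilpotent" means $[\mathfrak k,[\mathfrak k,[\mathfrak k,\mathfrak k]]]=0$. Let $\mathfrak k$ be a nilpotent Lie algebra with $\dim\mathcal Z(\mathfrak k)=1$. It is of type $(A)$ if either $[\mathcal C_2\mathfrak k,\mathcal C_2\mathfrak k]=0$ or $\mathcal C_2\mathfrak k=\mathfrak k$. It is of type $(A_+)$ if either $\mathcal C_2\mathfrak k$ is a maximal abelian subalgebra of $\mathfrak k$ or $\mathcal C_2\mathfrak k=\mathfrak k$. A grading of type $(A_+)$ of $\mathfrak k$ is a triple $\gamma=(\mathfrak z,\mathfrak c,\mathcal V)$ of linear subspaces with $\mathfrak k=\mathfrak z\dotplus\mathfrak c\dotplus\mathcal V$, $\mathfrak z=\mathcal Z(\mathfrak k)$, $[\mathfrak c,\mathfrak c]=0$, $[\mathcal V,\mathcal V]\subseteq\mathfrak c$, and such that the Lie bracket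 of $\mathfrak k$ gives rise to a duality pairing (nondegenerate bilinear map) $[\cdot,\cdot]\colon\mathfrak c\times\mathcal V\to\mathcal Z(\mathfrak k)\simeq\mathbb K$. *)

theory Defs
  imports "HOL-Computational_Algebra.Computational_Algebra"
begin

text \<open>The underlying vector space of a Lie algebra is the whole type \<open>'v\<close>, with scalar
  multiplication \<open>scale\<close> over the field \<open>'k\<close>.  Finite-dimensionality and the characteristic
  are not part of the locale.\<close>

locale lie_algebra = vector_space scale
  for scale :: "'k::field \<Rightarrow> 'v::ab_group_add \<Rightarrow> 'v" (infixr \<open>*s\<close> 75) +
  fixes bracket :: "'v \<Rightarrow> 'v \<Rightarrow> 'v" (\<open>\<lbrakk>_, _\<rbrakk>\<close>)
  assumes linear_right: "Vector_Spaces.linear (*s) (*s) (\<lambda>y. \<lbrakk>x, y\<rbrakk>)"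
    and linear_left: "Vector_Spaces.linear (*s) (*s) (\<lambda>x. \<lbrakk>x, y\<rbrakk>)"
    and alternating: "\<lbrakk>x, x\<rbrakk> = 0"
    and jacobi: "\<lbrakk>x, \<lbrakk>y, z\<rbrakk>\<rbrakk> + \<lbrakk>y, \<lbrakk>z, x\<rbrakk>\<rbrakk> + \<lbrakk>z, \<lbrakk>x, y\<rbrakk>\<rbrakk> = 0"
begin

definition bracket_sets :: "'v set \<Rightarrow> 'v set \<Rightarrow> 'v set"
  where "bracket_sets A B = span {\<lbrakk>a, b\<rbrakk> | a b. a \<in> A \<and> b \<in> B}"

definition center :: "'v set"
  where "center = {x. \<forall>y. \<lbrakk>y, x\<rbrakk> = 0}"

definition second_center :: "'v set"
  where "second_center = {x. bracket_sets UNIV (bracket_sets UNIV {x}) = {0}}"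

text \<open>Nilpotency of class at most 3.\<close>

definition three_step_nilpotent :: bool
  where "three_step_nilpotent \<longleftrightarrow>
    bracket_sets UNIV (bracket_sets UNIV (bracket_sets UNIV UNIV)) = {0}"

definition abelian_subalgebra :: "'v set \<Rightarrow> bool"
  where "abelian_subalgebra A \<longleftrightarrow> subspace A \<and> bracket_sets A A = {0}"

definition maximal_abelian_subalgebra :: "'v set \<Rightarrow> bool"
  where "maximal_abelian_subalgebra A \<longleftrightarrow>
    abelian_subalgebra A \<and> (\<forall>B. abelian_subalgebra B \<and> A \<subseteq> B \<longrightarrow> B = A)"

text \<open>The next two notions are meant for nilpotent Lie algebras with one-dimensional center;
  these standing hypotheses are not repeated in the definitions.\<close>

definition type_A :: bool
  where "type_A \<longleftrightarrow> bracket_sets second_center second_center = {0} \<or> second_center = UNIV"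

definition type_A_plus :: bool
  where "type_A_plus \<longleftrightarrow> maximal_abelian_subalgebra second_center \<or> second_center = UNIV"

definition direct_sum3 :: "'v set \<Rightarrow> 'v set \<Rightarrow> 'v set \<Rightarrow> bool"
  where "direct_sum3 A B C \<longleftrightarrow>
    (\<forall>x. \<exists>!(a, b, c). a \<in> A \<and> b \<in> B \<and> c \<in> C \<and> x = a + b + c)"

text \<open>The bracket restricts to a nondegenerate bilinear map from \<open>C \<times> V\<close> to the center
  (bilinearity is inherited from the bracket).  When the center is one-dimensional, this is a
  duality pairing after identifying the center with \<open>'k\<close>; nondegeneracy does not
  depend on that identification.\<close>

definition bracket_duality_pairing :: "'v set \<Rightarrow> 'v set \<Rightarrow> bool"
  where "bracket_duality_pairing C V \<longleftrightarrow>
    (\<forall>c\<in>C. \<forall>v\<in>V. \<lbrakk>c, v\<rbrakk> \<in> center) \<and>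
    (\<forall>c\<in>C. (\<forall>v\<in>V. \<lbrakk>c, v\<rbrakk> = 0) \<longrightarrow> c = 0) \<and>
    (\<forall>v\<in>V. (\<forall>c\<in>C. \<lbrakk>c, v\<rbrakk> = 0) \<longrightarrow> v = 0)"

definition grading_A_plus :: "'v set \<times> 'v set \<times> 'v set \<Rightarrow> bool"
  where "grading_A_plus = (\<lambda>(Z, C, V).
    subspace Z \<and> subspace C \<and> subspace V \<and> direct_sum3 Z C V \<and>
    Z = center \<and> bracket_sets C C = {0} \<and> bracket_sets V V \<subseteq> C \<and>
    bracket_duality_pairing C V)"

end

end

theory Submission
  imports Defs
begin

text \<open>A grading is built from any maximal abelian subalgebra \<open>M\<close> that contains all brackets and
  whose brackets are central: \<open>M\<close> is the second center if that is maximal abelian, and arbitrary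
  if the second center is everything.  Let \<open>C\<close> be a complement of the center in \<open>M\<close> and \<open>V\<close> a
  complement of \<open>M\<close>.  Maximality makes the pairing between \<open>C\<close> and \<open>V\<close> nondegenerate, so the central
  component of the bracket on \<open>V\<close> can be removed by replacing \<open>V\<close> with the graph of a map
  \<open>V \<rightarrow> C\<close>; this needs division by 2.

  Conversely, given a grading, \<open>\<lbrakk>C, V\<rbrakk>\<close> is central, so \<open>Z + C\<close> lies in the second center.  An element
  commuting with \<open>C\<close> has zero \<open>V\<close>-component by nondegeneracy, so no larger subalgebra is abelian.\<close>

section \<open>Nondegenerate pairings between subspaces\<close>

context finite_dimensional_vector_space
begin

text \<open>\<open>T\<close> records the values of \<open>\<beta> c\<close> on a basis
  \<open>E\<close> of \<open>V\<close> as coordinates. If they all vanish, \<open>\<beta> c\<close>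
  vanishes on \<open>V\<close>, so \<open>T\<close> is injective on \<open>C\<close>. Taking values
  in \<open>V\<close> itself instead of its dual lets dimensions be compared inside one
  space.\<close>

lemma left_nondegenerate_pairing_embeds:
  fixes \<beta> :: "'b \<Rightarrow> 'b \<Rightarrow> 'a"
  assumes C: "subspace C" and V: "subspace V"
    and add_left: "\<And>x y w. \<beta> (x + y) w = \<beta> x w + \<beta> y w"
    and scale_left: "\<And>r x w. \<beta> (scale r x) w = r * \<beta> x w"
    and add_right: "\<And>x y w. \<beta> w (x + y) = \<beta> w x + \<beta> w y"
    and scale_right: "\<And>r x w. \<beta> w (scale r x) = r * \<beta> w x"
    and inj: "\<And>c. c \<in> C \<Longrightarrow> (\<And>w. w \<in> V \<Longrightarrow> \<beta> c w = 0) \<Longrightarrow> c = 0"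
  obtains E T where "E \<subseteq> V" "independent E" "V \<subseteq> span E" "finite E"
    "T = (\<lambda>c. \<Sum>e\<in>E. scale (\<beta> c e) e)"
    "T ` C \<subseteq> V" "subspace (T ` C)" "dim (T ` C) = dim C"
proof -
  obtain E where E: "E \<subseteq> V" "independent E" "V \<subseteq> span E"
    by (rule maximal_independent_subset)
  have fin: "finite E" by (rule finiteI_independent[OF E(2)])
  define T where "T = (\<lambda>c. \<Sum>e\<in>E. scale (\<beta> c e) e)"
  interpret ep: finite_dimensional_vector_space_pair_1 scale Basis scale ..
  have linT: "Vector_Spaces.linear scale scale T"
    by (simp add: Vector_Spaces.linear_iff vector_space_axioms T_def add_left scale_left scale_left_distrib
        sum.distrib scale_sum_right)
  have zero_right: "\<beta> c 0 = 0" for c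
    using scale_right[of c 0 0] by simp
  have "inj_on T C"
    unfolding ep.linear_inj_on_iff_eq_0[OF linT C]
  proof (intro ballI impI)
    fix c assume c: "c \<in> C" "T c = 0"
    have E0: "\<beta> c e = 0" if "e \<in> E" for e
      using independentD[OF E(2) fin subset_refl _ that, of "\<beta> c"] c(2) by (simp add: T_def)
    have "\<beta> c w = 0" if "w \<in> span E" for w
      using that
      by (induction rule: span_induct_alt) (auto simp: zero_right add_right scale_right E0)
    then show "c = 0"
      using inj[OF c(1)] E(3) by blast
  qed
  then have "dim (T ` C) = dim C"
    using ep.dim_image_eq[OF linT, of C] span_eq_iff[of C] C by metis
  moreover have "T ` C \<subseteq> V"
    using E(1) V by (auto simp: T_def intro!: subspace_sum subspace_scale)
  moreover have "subspace (T ` C)"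
    by (rule ep.linear_subspace_image[OF linT C])
  ultimately show thesis
    using that E fin T_def by blast
qed

text \<open>Embedding each side into the other gives equal dimensions, so the embedding
  \<open>T\<close> of \<open>C\<close> is onto \<open>V\<close>, and every functional is some
  \<open>\<beta> c\<close> on \<open>V\<close>.\<close>

lemma nondegenerate_pairing_represents_functional:
  fixes \<beta> :: "'b \<Rightarrow> 'b \<Rightarrow> 'a"
  assumes C: "subspace C" and V: "subspace V"
    and add_left: "\<And>x y w. \<beta> (x + y) w = \<beta> x w + \<beta> y w"
    and scale_left: "\<And>r x w. \<beta> (scale r x) w = r * \<beta> x w"
    and add_right: "\<And>x y w. \<beta> w (x + y) = \<beta> w x + \<beta> w y"
    and scale_right: "\<And>r x w. \<beta> w (scale r x) = r * \<beta> w x"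
    and left: "\<And>c. c \<in> C \<Longrightarrow> (\<And>w. w \<in> V \<Longrightarrow> \<beta> c w = 0) \<Longrightarrow> c = 0"
    and right: "\<And>w. w \<in> V \<Longrightarrow> (\<And>c. c \<in> C \<Longrightarrow> \<beta> c w = 0) \<Longrightarrow> w = 0"
    and g_add: "\<And>x y. g (x + y) = g x + g y"
    and g_scale: "\<And>r x. g (scale r x) = r * g x"
  obtains c where "c \<in> C" "\<And>w. w \<in> V \<Longrightarrow> \<beta> c w = g w"
proof -
  obtain E T where E: "E \<subseteq> V" "independent E" "V \<subseteq> span E" "finite E"
    and T: "T = (\<lambda>c. \<Sum>e\<in>E. scale (\<beta> c e) e)"
    and TC: "T ` C \<subseteq> V" "subspace (T ` C)" "dim (T ` C) = dim C"
    by (rule left_nondegenerate_pairing_embeds[of C V \<beta>])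
      (auto simp: assms)
  \<comment> \<open>The same embedding for the pairing with its sides exchanged.\<close>
  have "dim V \<le> dim C"
    by (rule left_nondegenerate_pairing_embeds[of V C "\<lambda>x y. \<beta> y x"])
      (auto simp: assms dest: dim_subset)
  then have TCV: "T ` C = V"
    using subspace_dim_equal[OF TC(2) V TC(1)] TC(3) by simp
  \<comment> \<open>This vector has the values of \<open>g\<close> as coordinates, so a preimage
    under \<open>T\<close> agrees with \<open>g\<close> on the basis.\<close>
  have "(\<Sum>e\<in>E. scale (g e) e) \<in> V"
    using E(1) V by (auto intro!: subspace_sum subspace_scale)
  then obtain c where c: "c \<in> C" "T c = (\<Sum>e\<in>E. scale (g e) e)"
    using TCV by (metis imageE)
  have "(\<Sum>e\<in>E. scale (\<beta> c e - g e) e) = 0"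
    using c(2) by (simp add: T scale_left_diff_distrib sum_subtractf)
  then have eqE: "\<beta> c e = g e" if "e \<in> E" for e
    using independentD[OF E(2) E(4) subset_refl _ that, of "\<lambda>e. \<beta> c e - g e"] by simp
  have zero_right: "\<beta> c 0 = 0" and g_zero: "g 0 = 0"
    using scale_right[of c 0 0] g_scale[of 0 0] by simp_all
  have "\<beta> c w = g w" if "w \<in> span E" for w
    using that
    by (induction rule: span_induct_alt)
      (auto simp: zero_right g_zero add_right scale_right g_add g_scale eqE)
  then show thesis
    using that c(1) E(3) by blast
qed

end

section \<open>Projections and functionals\<close>

context vector_space
begin

text \<open>A left inverse of the identity on \<open>S\<close>, chosen with values in
  \<open>S\<close>.\<close>

lemma linear_projection_onto_subspace:
  assumes "subspace S"
  obtains p where "Vector_Spaces.linear scale scale p" "\<And>x. p x \<in> S" "\<And>x. x \<in> S \<Longrightarrow> p x = x"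
proof -
  interpret pr: vector_space_pair scale scale ..
  show thesis
    using pr.linear_exists_left_inverse_on[OF linear_ident assms] that by auto
qed

text \<open>The coordinate at \<open>z\<close> in a basis that extends \<open>{z}\<close>.\<close>

lemma linear_functional_eq_1:
  assumes "z \<noteq> 0"
  obtains f :: "'b \<Rightarrow> 'a" where "\<And>x y. f (x + y) = f x + f y" "\<And>r x. f (scale r x) = r * f x" "f z = 1"
proof -
  define B where "B = extend_basis {z}"
  have ind: "independent {z}" using assms by simp
  have B: "independent B" "z \<in> B" and spB: "span B = UNIV"
    using independent_extend_basis[OF ind] extend_basis_superset[OF ind] span_extend_basis[OF ind]
    by (auto simp: B_def)
  show thesis
    by (rule that[of "\<lambda>x. representation B x z"])
      (simp_all add: representation_add representation_scale representation_basis B spB)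
qed

end

section \<open>Brackets, centers and the consequences of a grading\<close>

context lie_algebra
begin

lemma
  shows bracket_add_right: "\<lbrakk>x, y + z\<rbrakk> = \<lbrakk>x, y\<rbrakk> + \<lbrakk>x, z\<rbrakk>"
    and bracket_scale_right: "\<lbrakk>x, r *s y\<rbrakk> = r *s \<lbrakk>x, y\<rbrakk>"
    and bracket_add_left: "\<lbrakk>y + z, x\<rbrakk> = \<lbrakk>y, x\<rbrakk> + \<lbrakk>z, x\<rbrakk>"
    and bracket_scale_left: "\<lbrakk>r *s y, x\<rbrakk> = r *s \<lbrakk>y, x\<rbrakk>"
    and bracket_zero_right [simp]: "\<lbrakk>x, 0\<rbrakk> = 0"
    and bracket_zero_left [simp]: "\<lbrakk>0, x\<rbrakk> = 0"
proof -
  interpret R: Vector_Spaces.linear scale scale "\<lambda>y. \<lbrakk>x, y\<rbrakk>" by (rule linear_right)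
  interpret L: Vector_Spaces.linear scale scale "\<lambda>y. \<lbrakk>y, x\<rbrakk>" by (rule linear_left)
  show "\<lbrakk>x, y + z\<rbrakk> = \<lbrakk>x, y\<rbrakk> + \<lbrakk>x, z\<rbrakk>" "\<lbrakk>x, r *s y\<rbrakk> = r *s \<lbrakk>x, y\<rbrakk>"
    "\<lbrakk>y + z, x\<rbrakk> = \<lbrakk>y, x\<rbrakk> + \<lbrakk>z, x\<rbrakk>" "\<lbrakk>r *s y, x\<rbrakk> = r *s \<lbrakk>y, x\<rbrakk>" "\<lbrakk>x, 0\<rbrakk> = 0" "\<lbrakk>0, x\<rbrakk> = 0"
    by (rule R.add R.scale L.add L.scale R.zero L.zero)+
qed

lemmas bracket_bilinear = bracket_add_right bracket_scale_right bracket_add_left bracket_scale_left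

lemma bracket_antisym: "\<lbrakk>y, x\<rbrakk> = - \<lbrakk>x, y\<rbrakk>"
proof -
  have "\<lbrakk>y, x\<rbrakk> + \<lbrakk>x, y\<rbrakk> = 0"
    using alternating[of "x + y", unfolded bracket_bilinear] by (simp add: alternating ac_simps)
  then show ?thesis
    by (simp add: eq_neg_iff_add_eq_0)
qed

lemma bracket_eq_0_commute: "\<lbrakk>y, x\<rbrakk> = 0 \<longleftrightarrow> \<lbrakk>x, y\<rbrakk> = 0"
  by (subst bracket_antisym) simp

lemma bracket_in_bracket_sets: "a \<in> A \<Longrightarrow> b \<in> B \<Longrightarrow> \<lbrakk>a, b\<rbrakk> \<in> bracket_sets A B"
  unfolding bracket_sets_def by (rule span_base) blast

lemma bracket_sets_subset_iff:
  assumes "subspace C"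
  shows "bracket_sets A B \<subseteq> C \<longleftrightarrow> (\<forall>a\<in>A. \<forall>b\<in>B. \<lbrakk>a, b\<rbrakk> \<in> C)"
proof
  show "\<forall>a\<in>A. \<forall>b\<in>B. \<lbrakk>a, b\<rbrakk> \<in> C" if "bracket_sets A B \<subseteq> C"
    using that bracket_in_bracket_sets by blast
  show "bracket_sets A B \<subseteq> C" if "\<forall>a\<in>A. \<forall>b\<in>B. \<lbrakk>a, b\<rbrakk> \<in> C"
    unfolding bracket_sets_def using that by (intro span_minimal[OF _ assms]) blast
qed

lemma bracket_sets_eq_0_iff: "bracket_sets A B = {0} \<longleftrightarrow> (\<forall>a\<in>A. \<forall>b\<in>B. \<lbrakk>a, b\<rbrakk> = 0)"
proof -
  have "0 \<in> bracket_sets A B"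
    unfolding bracket_sets_def by (rule span_zero)
  then show ?thesis
    using bracket_sets_subset_iff[OF subspace_single_0, of A B] by auto
qed

lemma subspace_center: "subspace center"
  by (auto simp: subspace_def center_def bracket_bilinear)

text \<open>Being killed by one more bracket means lying in the center, and since the center is a
  subspace this can be tested on single brackets.\<close>

lemma second_center_eq: "second_center = {x. \<forall>y. \<lbrakk>y, x\<rbrakk> \<in> center}"
proof -
  have "bracket_sets UNIV (bracket_sets UNIV {x}) = {0} \<longleftrightarrow> bracket_sets UNIV {x} \<subseteq> center" for x
    by (auto simp: bracket_sets_eq_0_iff center_def)
  then show ?thesis
    by (auto simp: second_center_def bracket_sets_subset_iff[OF subspace_center])
qed

lemma subspace_second_center: "subspace second_center"
  using subspace_center by (auto simp: subspace_def second_center_eq bracket_bilinear)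

lemma three_step_bracket_in_second_center:
  assumes "three_step_nilpotent"
  shows "\<lbrakk>x, y\<rbrakk> \<in> second_center"
proof -
  have "\<lbrakk>a, \<lbrakk>b, \<lbrakk>x, y\<rbrakk>\<rbrakk>\<rbrakk> = 0" for a b
    using assms unfolding three_step_nilpotent_def bracket_sets_eq_0_iff
    by (blast intro: bracket_in_bracket_sets)
  then show ?thesis
    by (simp add: second_center_eq center_def)
qed

text \<open>\<open>v\<close> commutes with \<open>M\<close> and with itself, so
  \<open>M + span {v}\<close> is abelian and by maximality equals \<open>M\<close>.\<close>

lemma maximal_abelian_subalgebra_centralizer:
  assumes M: "maximal_abelian_subalgebra M" and v: "\<And>m. m \<in> M \<Longrightarrow> \<lbrakk>m, v\<rbrakk> = 0"
  shows "v \<in> M"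
proof -
  have sM: "subspace M" and ab: "\<And>a b. a \<in> M \<Longrightarrow> b \<in> M \<Longrightarrow> \<lbrakk>a, b\<rbrakk> = 0"
    using M by (auto simp: maximal_abelian_subalgebra_def abelian_subalgebra_def bracket_sets_eq_0_iff)
  define B where "B = {m + w | m w. m \<in> M \<and> w \<in> span {v}}"
  have "\<lbrakk>m, v\<rbrakk> = 0" "\<lbrakk>v, m\<rbrakk> = 0" if "m \<in> M" for m
    using v[OF that] bracket_eq_0_commute by auto
  moreover have "subspace B"
    unfolding B_def by (rule subspace_sums[OF sM subspace_span])
  ultimately have "abelian_subalgebra B"
    unfolding abelian_subalgebra_def bracket_sets_eq_0_iff
    by (auto simp: B_def span_singleton bracket_bilinear ab alternating)
  moreover have "M \<subseteq> B"
    using span_zero[of "{v}"] unfolding B_def by force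
  moreover have "v \<in> B"
    using span_base[of v "{v}"] subspace_0[OF sM] unfolding B_def by force
  ultimately show ?thesis
    using M unfolding maximal_abelian_subalgebra_def by blast
qed

text \<open>Subtracting two decompositions of \<open>x\<close> componentwise reduces uniqueness to
  decompositions of 0.\<close>

lemma direct_sum3I:
  assumes A: "subspace A" and B: "subspace B" and C: "subspace C"
    and sum: "\<And>x. \<exists>a\<in>A. \<exists>b\<in>B. \<exists>c\<in>C. x = a + b + c"
    and zero: "\<And>a b c. a \<in> A \<Longrightarrow> b \<in> B \<Longrightarrow> c \<in> C \<Longrightarrow> a + b + c = 0 \<Longrightarrow> a = 0 \<and> b = 0 \<and> c = 0"
  shows "direct_sum3 A B C"
  unfolding direct_sum3_def
proof
  fix x
  obtain a b c where abc: "a \<in> A" "b \<in> B" "c \<in> C" "x = a + b + c"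
    using sum by blast
  show "\<exists>!(a, b, c). a \<in> A \<and> b \<in> B \<and> c \<in> C \<and> x = a + b + c"
  proof (rule ex1I[of _ "(a, b, c)"])
    fix t assume "case t of (a, b, c) \<Rightarrow> a \<in> A \<and> b \<in> B \<and> c \<in> C \<and> x = a + b + c"
    then obtain a' b' c' where t: "t = (a', b', c')" "a' \<in> A" "b' \<in> B" "c' \<in> C" "x = a' + b' + c'"
      by (cases t) auto
    have "(a' - a) + (b' - b) + (c' - c) = 0"
      using abc(4) t(5) by (simp add: algebra_simps)
    with zero[of "a' - a" "b' - b" "c' - c"] show "t = (a, b, c)"
      using abc t A B C by (simp add: subspace_diff)
  qed (use abc in simp)
qed

text \<open>If the second center is proper, type (A) makes it abelian, and only maximality is left.
  It contains the center and \<open>C\<close>, so it suffices to kill the \<open>V\<close>-component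
  of any element of a larger abelian \<open>B\<close>.\<close>

lemma grading_A_plus_imp_type_A_plus:
  assumes A: "type_A" and grading: "grading_A_plus (Z, C, V)"
  shows "type_A_plus"
proof (cases "second_center = UNIV")
  case False
  then have ab: "abelian_subalgebra second_center"
    using A subspace_second_center by (simp add: type_A_def abelian_subalgebra_def)
  have Z: "Z = center" and ds: "direct_sum3 Z C V" and sC: "subspace second_center"
    and CC: "\<And>x y. x \<in> C \<Longrightarrow> y \<in> C \<Longrightarrow> \<lbrakk>x, y\<rbrakk> = 0"
    and CV: "\<And>x y. x \<in> C \<Longrightarrow> y \<in> V \<Longrightarrow> \<lbrakk>x, y\<rbrakk> \<in> center"
    and nondeg: "\<And>v. v \<in> V \<Longrightarrow> (\<And>c. c \<in> C \<Longrightarrow> \<lbrakk>c, v\<rbrakk> = 0) \<Longrightarrow> v = 0"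
    using grading subspace_second_center
    by (auto simp: grading_A_plus_def bracket_sets_eq_0_iff bracket_duality_pairing_def)
  have decomp: "\<exists>z\<in>center. \<exists>c\<in>C. \<exists>v\<in>V. x = z + c + v" for x
    using ds Z unfolding direct_sum3_def by fast
  have central: "\<lbrakk>y, z\<rbrakk> = 0" "\<lbrakk>z, y\<rbrakk> = 0" if "z \<in> center" for y z
    using that bracket_eq_0_commute by (auto simp: center_def)
  have C_sub: "c \<in> second_center" if c: "c \<in> C" for c
    unfolding second_center_eq
  proof safe
    fix y
    obtain z c' v where y: "z \<in> center" "c' \<in> C" "v \<in> V" "y = z + c' + v"
      using decomp by blast
    \<comment> \<open>Only the \<open>V\<close>-component of \<open>y\<close> contributes, because
      \<open>z\<close> is central and \<open>C\<close> is abelian.\<close>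
    have "\<lbrakk>y, c\<rbrakk> = - \<lbrakk>c, v\<rbrakk>"
      using y c by (simp add: bracket_bilinear central CC bracket_antisym[of v c])
    then show "\<lbrakk>y, c\<rbrakk> \<in> center"
      using CV[OF c y(3)] subspace_center by (simp add: subspace_neg)
  qed
  have Z_sub: "z \<in> second_center" if "z \<in> center" for z
    using that subspace_0[OF subspace_center] by (simp add: second_center_eq central)
  have "B = second_center" if B: "abelian_subalgebra B" "second_center \<subseteq> B" for B
  proof -
    have "b \<in> second_center" if b: "b \<in> B" for b
    proof -
      obtain z c v where y: "z \<in> center" "c \<in> C" "v \<in> V" "b = z + c + v"
        using decomp by blast
      have "\<lbrakk>c', v\<rbrakk> = 0" if c': "c' \<in> C" for c'
      proof -
        \<comment> \<open>\<open>c'\<close> lies in the second center, hence in the abelian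
          subalgebra \<open>B\<close> together with \<open>b\<close>.\<close>
        have "\<lbrakk>c', b\<rbrakk> = 0"
          using B b C_sub[OF c'] by (auto simp: abelian_subalgebra_def bracket_sets_eq_0_iff)
        then show ?thesis
          using y c' by (simp add: bracket_bilinear central CC)
      qed
      then have "v = 0"
        using nondeg y(3) by blast
      then show ?thesis
        using y C_sub Z_sub sC by (simp add: subspace_add)
    qed
    then show ?thesis using B(2) by blast
  qed
  then show ?thesis
    using ab by (auto simp: type_A_plus_def maximal_abelian_subalgebra_def)
qed (simp add: type_A_plus_def)

end

section \<open>Construction of a grading in finite dimension\<close>

locale finite_dimensional_lie_algebra =
  lie_algebra scale bracket + finite_dimensional_vector_space scale Basis
  for scale :: "'k::field \<Rightarrow> 'v::ab_group_add \<Rightarrow> 'v" (infixr \<open>*s\<close> 75)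
    and bracket :: "'v \<Rightarrow> 'v \<Rightarrow> 'v" (\<open>\<lbrakk>_, _\<rbrakk>\<close>)
    and Basis :: "'v set"
begin

text \<open>An abelian subalgebra of greatest dimension is maximal, since nested subspaces of equal
  dimension coincide.\<close>

lemma maximal_abelian_subalgebra_exists: "\<exists>M. maximal_abelian_subalgebra M"
proof -
  have "abelian_subalgebra {0}"
    by (simp add: abelian_subalgebra_def bracket_sets_eq_0_iff)
  then obtain M where M: "abelian_subalgebra M" "\<And>B. abelian_subalgebra B \<Longrightarrow> dim B \<le> dim M"
    using ex_has_greatest_nat[of abelian_subalgebra "{0}" dim "Suc dimension"] dim_subset_UNIV
    by (metis le_imp_less_Suc)
  then have "maximal_abelian_subalgebra M"
    unfolding maximal_abelian_subalgebra_def
    by (metis abelian_subalgebra_def subspace_dim_equal)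
  then show ?thesis ..
qed

text \<open>A functional \<open>f\<close> that is faithful on the center makes the central brackets
  scalar. With \<open>C\<close> the kernel of \<open>f\<close> in \<open>M\<close>, an element of
  \<open>M\<close> lies in \<open>C\<close> as soon as \<open>f\<close> kills it, so making
  \<open>f\<close> vanish on brackets is all that the correction of \<open>V\<close> has to
  achieve.\<close>

lemma maximal_abelian_subalgebra_grading:
  assumes char: "CHAR('k) \<noteq> 2" and dim1: "dim center = 1"
    and M: "maximal_abelian_subalgebra M"
    and M_center: "\<And>x m. m \<in> M \<Longrightarrow> \<lbrakk>m, x\<rbrakk> \<in> center"
    and comm_M: "\<And>x y. \<lbrakk>x, y\<rbrakk> \<in> M"
  shows "\<exists>\<gamma>. grading_A_plus \<gamma>"
proof -
  \<comment> \<open>Otherwise the characteristic would divide the prime 2 without being 1 or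
    2.\<close>
  have two: "(2::'k) \<noteq> 0"
  proof
    assume "(2::'k) = 0"
    then have "CHAR('k) dvd 2"
      using of_nat_eq_0_iff_char_dvd[of 2, where ?'a = 'k] by simp
    then show False
      using char CHAR_not_1'[where ?'a = 'k] two_is_prime_nat[unfolded prime_nat_iff] by auto
  qed
  have sM: "subspace M" and ab: "\<And>a b. a \<in> M \<Longrightarrow> b \<in> M \<Longrightarrow> \<lbrakk>a, b\<rbrakk> = 0"
    using M by (auto simp: maximal_abelian_subalgebra_def abelian_subalgebra_def bracket_sets_eq_0_iff)
  have central: "\<lbrakk>y, z\<rbrakk> = 0" "\<lbrakk>z, y\<rbrakk> = 0" if "z \<in> center" for y z
    using that bracket_eq_0_commute by (auto simp: center_def)
  have center_M: "z \<in> M" if "z \<in> center" for z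
    by (rule maximal_abelian_subalgebra_centralizer[OF M]) (simp add: central that)
  obtain z where z: "z \<noteq> 0" "z \<in> center" and center_span: "center = span {z}"
  proof -
    obtain B where B: "B \<subseteq> center" "independent B" "center \<subseteq> span B" "card B = 1"
      using basis_exists[of center] dim1 by metis
    obtain z where Bz: "B = {z}"
      using B(4) by (rule card_1_singletonE)
    show thesis
    proof (rule that)
      show "z \<noteq> 0" "z \<in> center"
        using B(1,2) by (simp_all add: Bz)
      show "center = span {z}"
        using span_subspace[OF B(1,3) subspace_center] by (simp only: Bz)
    qed
  qed
  obtain f :: "'v \<Rightarrow> 'k" where f: "\<And>x y. f (x + y) = f x + f y" "\<And>r x. f (r *s x) = r * f x"
    and fz: "f z = 1"
    by (rule linear_functional_eq_1[OF z(1)]) blast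
  have f0 [simp]: "f 0 = 0"
    using f(2)[of 0 0] by simp
  have f_diff: "f (x - y) = f x - f y" for x y
    using f(1)[of "x - y" y] by simp
  have f_swap: "f \<lbrakk>y, x\<rbrakk> = - f \<lbrakk>x, y\<rbrakk>" for x y
    using f_diff[of 0 "\<lbrakk>x, y\<rbrakk>"] by (simp add: bracket_antisym[of y x])
  have f_center: "x = 0" if "x \<in> center" "f x = 0" for x
    using that fz by (auto simp: center_span span_singleton f)
  \<comment> \<open>A complement of the center in \<open>M\<close>: subtracting
    \<open>f m *s z\<close> moves \<open>m\<close> into it because \<open>f z = 1\<close>.\<close>
  define C where "C = {m \<in> M. f m = 0}"
  have sC: "subspace C"
    using sM by (auto simp: C_def subspace_def f)
  have M_decomp: "m - f m *s z \<in> C" if "m \<in> M" for m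
    using that center_M[OF z(2)] sM by (simp add: C_def subspace_diff subspace_scale f f_diff fz)
  obtain p where linp: "Vector_Spaces.linear (*s) (*s) p" and pM: "\<And>x. p x \<in> M"
    and p_id: "\<And>x. x \<in> M \<Longrightarrow> p x = x"
    using linear_projection_onto_subspace[OF sM] by blast
  interpret p: Vector_Spaces.linear scale scale p by (rule linp)
  define V where "V = {x. p x = 0}"
  have sV: "subspace V"
    unfolding V_def by (rule p.subspace_kernel)
  have V_decomp: "x - p x \<in> V" for x
    by (simp add: V_def p.diff p_id pM)
  have VM: "v = 0" if "v \<in> V" "v \<in> M" for v
    using that p_id by (auto simp: V_def)

  have CM: "c \<in> M" if "c \<in> C" for c
    using that by (simp add: C_def)
  \<comment> \<open>Since \<open>f\<close> is faithful on the center, \<open>c\<close> commutes with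
    \<open>V\<close>; it also commutes with the abelian \<open>M\<close>, so it is central, and
    \<open>f c = 0\<close> finishes.\<close>
  have left: "c = 0" if c: "c \<in> C" and "\<And>w. w \<in> V \<Longrightarrow> f \<lbrakk>c, w\<rbrakk> = 0" for c
  proof -
    have "\<lbrakk>c, x\<rbrakk> = 0" for x
    proof -
      have "\<lbrakk>c, x - p x\<rbrakk> = 0"
        using f_center M_center CM[OF c] that(2) V_decomp by blast
      then show ?thesis
        using bracket_add_right[of c "x - p x" "p x"] ab[OF CM[OF c] pM] by simp
    qed
    then have "c \<in> center"
      by (simp add: center_def bracket_eq_0_commute)
    then show ?thesis
      using f_center c by (simp add: C_def)
  qed
  \<comment> \<open>Commuting with \<open>C\<close> and with the center, \<open>v\<close>
    centralizes \<open>M\<close>. Maximality puts it into \<open>M\<close>, which meets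
    \<open>V\<close> only in 0.\<close>
  have right: "v = 0" if v: "v \<in> V" and "\<And>c. c \<in> C \<Longrightarrow> f \<lbrakk>c, v\<rbrakk> = 0" for v
  proof -
    have "\<lbrakk>m, v\<rbrakk> = 0" if m: "m \<in> M" for m
    proof -
      have "\<lbrakk>m - f m *s z, v\<rbrakk> = 0"
        using f_center M_center CM M_decomp[OF m] \<open>\<And>c. c \<in> C \<Longrightarrow> f \<lbrakk>c, v\<rbrakk> = 0\<close> by blast
      then show ?thesis
        using bracket_add_left[of "m - f m *s z" "f m *s z" v] z(2)
        by (simp add: bracket_scale_left central)
    qed
    then show ?thesis
      using VM[OF v] maximal_abelian_subalgebra_centralizer[OF M] by blast
  qed

  \<comment> \<open>the graph of the map \<open>\<phi> : V \<rightarrow> C\<close> with \<open>f \<lbrakk>\<phi> v, w\<rbrakk> = - f \<lbrakk>v, w\<rbrakk> / 2\<close>\<close>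
  define W where "W = {v + c | v c. v \<in> V \<and> c \<in> C \<and> (\<forall>w\<in>V. 2 * f \<lbrakk>c, w\<rbrakk> + f \<lbrakk>v, w\<rbrakk> = 0)}"
  have W_I: "v + c \<in> W" if "v \<in> V" "c \<in> C" "\<And>w. w \<in> V \<Longrightarrow> 2 * f \<lbrakk>c, w\<rbrakk> + f \<lbrakk>v, w\<rbrakk> = 0" for v c
    using that unfolding W_def by blast
  \<comment> \<open>The equation that defines \<open>W\<close> is linear in the pair
    \<open>(v, c)\<close>, so closure follows without solving it for \<open>c\<close>.\<close>
  have sW: "subspace W"
  proof (rule subspaceI)
    show "0 \<in> W"
      using W_I[of 0 0] subspace_0[OF sV] subspace_0[OF sC] by simp
  next
    fix x y assume "x \<in> W" "y \<in> W"
    then obtain v c v' c' where x: "x = v + c" "v \<in> V" "c \<in> C" "\<And>w. w \<in> V \<Longrightarrow> 2 * f \<lbrakk>c, w\<rbrakk> + f \<lbrakk>v, w\<rbrakk> = 0"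
      and y: "y = v' + c'" "v' \<in> V" "c' \<in> C" "\<And>w. w \<in> V \<Longrightarrow> 2 * f \<lbrakk>c', w\<rbrakk> + f \<lbrakk>v', w\<rbrakk> = 0"
      unfolding W_def by blast
    have "2 * f \<lbrakk>c + c', w\<rbrakk> + f \<lbrakk>v + v', w\<rbrakk> = 0" if "w \<in> V" for w
    proof -
      have "2 * f \<lbrakk>c + c', w\<rbrakk> + f \<lbrakk>v + v', w\<rbrakk>
        = (2 * f \<lbrakk>c, w\<rbrakk> + f \<lbrakk>v, w\<rbrakk>) + (2 * f \<lbrakk>c', w\<rbrakk> + f \<lbrakk>v', w\<rbrakk>)"
        by (simp add: bracket_bilinear f algebra_simps)
      then show ?thesis using x(4) y(4) that by simp
    qed
    then have "(v + v') + (c + c') \<in> W"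
      using x y sV sC by (intro W_I) (simp_all add: subspace_add)
    then show "x + y \<in> W"
      by (simp add: x(1) y(1) algebra_simps)
  next
    fix r x assume "x \<in> W"
    then obtain v c where x: "x = v + c" "v \<in> V" "c \<in> C" "\<And>w. w \<in> V \<Longrightarrow> 2 * f \<lbrakk>c, w\<rbrakk> + f \<lbrakk>v, w\<rbrakk> = 0"
      unfolding W_def by blast
    have "2 * f \<lbrakk>r *s c, w\<rbrakk> + f \<lbrakk>r *s v, w\<rbrakk> = 0" if "w \<in> V" for w
    proof -
      have "2 * f \<lbrakk>r *s c, w\<rbrakk> + f \<lbrakk>r *s v, w\<rbrakk> = r * (2 * f \<lbrakk>c, w\<rbrakk> + f \<lbrakk>v, w\<rbrakk>)"
        by (simp add: bracket_bilinear f algebra_simps)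
      then show ?thesis using x(4) that by simp
    qed
    then have "r *s v + r *s c \<in> W"
      using x sV sC by (intro W_I) (simp_all add: subspace_scale)
    then show "r *s x \<in> W"
      by (simp add: x(1) scale_right_distrib)
  qed
  \<comment> \<open>The functional sending \<open>w\<close> to
    \<open>- f \<lbrakk>v, w\<rbrakk> / 2\<close> is represented by some \<open>c\<close> through
    the pairing of \<open>C\<close> with \<open>V\<close>.\<close>
  have lift: "\<exists>c\<in>C. v + c \<in> W" if v: "v \<in> V" for v
  proof -
    obtain c where c: "c \<in> C" "\<And>w. w \<in> V \<Longrightarrow> f \<lbrakk>c, w\<rbrakk> = - f \<lbrakk>v, w\<rbrakk> / 2"
      by (rule nondegenerate_pairing_represents_functional[OF sC sV,
            of "\<lambda>x y. f \<lbrakk>x, y\<rbrakk>" "\<lambda>w. - f \<lbrakk>v, w\<rbrakk> / 2"])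
        (auto simp: bracket_bilinear f left right add_divide_distrib diff_divide_distrib)
    then have "v + c \<in> W"
      using v two by (intro W_I) simp_all
    then show ?thesis using c(1) by blast
  qed
  have W_bracket: "\<lbrakk>x, y\<rbrakk> \<in> C" if "x \<in> W" "y \<in> W" for x y
  proof -
    obtain v c w d where x: "x = v + c" "v \<in> V" "c \<in> C" "\<And>u. u \<in> V \<Longrightarrow> 2 * f \<lbrakk>c, u\<rbrakk> + f \<lbrakk>v, u\<rbrakk> = 0"
      and y: "y = w + d" "w \<in> V" "d \<in> C" "\<And>u. u \<in> V \<Longrightarrow> 2 * f \<lbrakk>d, u\<rbrakk> + f \<lbrakk>w, u\<rbrakk> = 0"
      using \<open>x \<in> W\<close> \<open>y \<in> W\<close> unfolding W_def by blast
    \<comment> \<open>The term \<open>\<lbrakk>c, d\<rbrakk>\<close> vanishes. By antisymmetry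
      \<open>2 * f \<lbrakk>v, w\<rbrakk>\<close> is split between the equation for \<open>c\<close>
      at \<open>w\<close> and the one for \<open>d\<close> at \<open>v\<close>, whose difference is
      0.\<close>
    have "2 * f \<lbrakk>x, y\<rbrakk> = 2 * f \<lbrakk>v, w\<rbrakk> - 2 * f \<lbrakk>d, v\<rbrakk> + 2 * f \<lbrakk>c, w\<rbrakk>"
      by (simp add: x(1) y(1) bracket_bilinear f ab CM x(3) y(3) f_swap[of v d] algebra_simps)
    also have "\<dots> = (2 * f \<lbrakk>c, w\<rbrakk> + f \<lbrakk>v, w\<rbrakk>) - (2 * f \<lbrakk>d, v\<rbrakk> + f \<lbrakk>w, v\<rbrakk>)"
      by (simp add: f_swap[of w v])
    also have "\<dots> = 0"
      using x(2,4) y(2,4) by simp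
    finally have "f \<lbrakk>x, y\<rbrakk> = 0"
      using two by simp
    then show ?thesis
      by (simp add: C_def comm_M)
  qed
  \<comment> \<open>The summand \<open>c\<close> does not affect brackets with \<open>C\<close>, so
    \<open>right\<close> gives \<open>v = 0\<close>. The defining equation then says that
    \<open>c\<close> pairs to zero with \<open>V\<close>.\<close>
  have W_zero: "x = 0" if "x \<in> W" "\<And>c. c \<in> C \<Longrightarrow> \<lbrakk>c, x\<rbrakk> = 0" for x
  proof -
    obtain v c where x: "x = v + c" "v \<in> V" "c \<in> C" "\<And>u. u \<in> V \<Longrightarrow> 2 * f \<lbrakk>c, u\<rbrakk> + f \<lbrakk>v, u\<rbrakk> = 0"
      using \<open>x \<in> W\<close> unfolding W_def by blast
    have "f \<lbrakk>c', v\<rbrakk> = 0" if "c' \<in> C" for c'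
      using \<open>\<And>c. c \<in> C \<Longrightarrow> \<lbrakk>c, x\<rbrakk> = 0\<close>[OF that] that x(3)
      by (simp add: x(1) bracket_bilinear ab CM)
    then have "v = 0"
      using right[OF x(2)] by blast
    then have "c = 0"
      using left[OF x(3)] x(4) two by simp
    with \<open>v = 0\<close> x(1) show ?thesis by simp
  qed
  have "direct_sum3 center C W"
  proof (rule direct_sum3I[OF subspace_center sC sW])
    fix x
    obtain c where c: "c \<in> C" "x - p x + c \<in> W"
      using lift[OF V_decomp] by blast
    \<comment> \<open>The correction added to the \<open>V\<close>-component of \<open>x\<close> is
      taken back from its \<open>M\<close>-component.\<close>
    define m where "m = p x - c"
    have "m \<in> M"
      using pM CM[OF c(1)] sM by (simp add: m_def subspace_diff)
    moreover have "x = f m *s z + (m - f m *s z) + (x - p x + c)"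
      by (simp add: m_def)
    ultimately show "\<exists>a\<in>center. \<exists>b\<in>C. \<exists>c\<in>W. x = a + b + c"
      using M_decomp c(2) subspace_scale[OF subspace_center z(2)] by blast
  next
    fix a b c assume abc: "a \<in> center" "b \<in> C" "c \<in> W" "a + b + c = 0"
    \<comment> \<open>So the component in \<open>W\<close> lies in \<open>M\<close>, commutes with
      \<open>C\<close> and is 0 by \<open>W_zero\<close>. Applying \<open>f\<close>, which vanishes
      on \<open>C\<close>, then isolates \<open>a\<close>.\<close>
    have "c = - (a + b)"
      using abc(4) by (metis add.inverse_inverse minus_unique)
    then have "c \<in> M"
      using center_M[OF abc(1)] CM[OF abc(2)] sM subspace_neg subspace_add by blast
    then have "c = 0"
      using W_zero[OF abc(3)] ab CM by blast
    moreover from this have "f a + f b = 0"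
      using abc(4) f(1)[of a b] by simp
    then have "a = 0"
      using f_center[OF abc(1)] abc(2) by (simp add: C_def)
    ultimately show "a = 0 \<and> b = 0 \<and> c = 0"
      using abc(4) by simp
  qed
  moreover have "bracket_duality_pairing C W"
    unfolding bracket_duality_pairing_def
  proof (intro conjI ballI impI)
    fix c assume c: "c \<in> C" "\<forall>v\<in>W. \<lbrakk>c, v\<rbrakk> = 0"
    show "c = 0"
    \<comment> \<open>Nondegeneracy on \<open>C\<close> carries over from \<open>V\<close> to
      \<open>W\<close>, since \<open>w\<close> and \<open>w + d\<close> have the same bracket with
      \<open>c\<close>.\<close>
    proof (rule left[OF c(1)])
      fix w assume "w \<in> V"
      then obtain d where "d \<in> C" "w + d \<in> W"
        using lift by blast
      then have "\<lbrakk>c, w\<rbrakk> = 0"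
        using c bracket_add_right[of c w d] ab CM by simp
      then show "f \<lbrakk>c, w\<rbrakk> = 0" by simp
    qed
  qed (use M_center CM W_zero in blast)+
  ultimately have "grading_A_plus (center, C, W)"
    using subspace_center sC sW ab CM W_bracket
    by (auto simp: grading_A_plus_def bracket_sets_eq_0_iff bracket_sets_subset_iff)
  then show ?thesis ..
qed

text \<open>Type (A) is immediate from type (A+), so the forward direction amounts to choosing the
  \<open>M\<close> from which a grading is built.\<close>

lemma type_A_plus_iff:
  assumes char: "CHAR('k) \<noteq> 2" and nil: "three_step_nilpotent" and dim1: "dim center = 1"
  shows "type_A_plus \<longleftrightarrow> type_A \<and> (\<exists>\<gamma>. grading_A_plus \<gamma>)"
proof
  assume "type_A \<and> (\<exists>\<gamma>. grading_A_plus \<gamma>)"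
  then show "type_A_plus"
    using grading_A_plus_imp_type_A_plus by (metis prod_cases3)
next
  assume plus: "type_A_plus"
  have C2: "\<lbrakk>m, x\<rbrakk> \<in> center" if "m \<in> second_center" for m x
  proof -
    have "- \<lbrakk>x, m\<rbrakk> \<in> center"
      using that subspace_neg[OF subspace_center] by (simp add: second_center_eq)
    then show ?thesis
      by (simp add: bracket_antisym[of m x])
  qed
  have "\<exists>\<gamma>. grading_A_plus \<gamma>"
  proof (cases "second_center = UNIV")
    case True
    obtain M where M: "maximal_abelian_subalgebra M"
      using maximal_abelian_subalgebra_exists by blast
    have cen: "\<lbrakk>x, y\<rbrakk> \<in> center" for x y
      using C2 True by blast
    \<comment> \<open>Every bracket is central here, so it centralizes \<open>M\<close> and lies in
      it.\<close>
    have "\<lbrakk>x, y\<rbrakk> \<in> M" for x y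
      using cen[of x y] by (intro maximal_abelian_subalgebra_centralizer[OF M]) (simp add: center_def)
    then show ?thesis
      by (rule maximal_abelian_subalgebra_grading[OF char dim1 M cen])
  next
    case False
    then have "maximal_abelian_subalgebra second_center"
      using plus by (simp add: type_A_plus_def)
    \<comment> \<open>Three-step nilpotency puts all brackets into the second center, as the
      construction demands of \<open>M\<close>.\<close>
    then show ?thesis
      by (rule maximal_abelian_subalgebra_grading[OF char dim1])
        (auto intro: C2 three_step_bracket_in_second_center[OF nil])
  qed
  then show "type_A \<and> (\<exists>\<gamma>. grading_A_plus \<gamma>)"
    using plus
    by (auto simp: type_A_def type_A_plus_def maximal_abelian_subalgebra_def abelian_subalgebra_def)
qed

end

theorem theorem4p1:
  fixes scale :: "'k::field \<Rightarrow> 'v::ab_group_add \<Rightarrow> 'v"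
    and bracket :: "'v \<Rightarrow> 'v \<Rightarrow> 'v"
    and Basis :: "'v set"
  assumes "CHAR('k) \<noteq> 2"
    and "lie_algebra scale bracket"
    and "finite_dimensional_vector_space scale Basis"
    and "lie_algebra.three_step_nilpotent scale bracket"
    and "vector_space.dim scale (lie_algebra.center bracket) = 1"
  shows "lie_algebra.type_A_plus scale bracket \<longleftrightarrow>
    lie_algebra.type_A scale bracket \<and>
    (\<exists>\<gamma>. lie_algebra.grading_A_plus scale bracket \<gamma>)"
proof -
  interpret finite_dimensional_lie_algebra scale bracket Basis
    using assms(2,3) by (simp add: finite_dimensional_lie_algebra_def)
  show ?thesis
    using assms(1,4,5) by (rule type_A_plus_iff)
qed

end
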